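(* Let $p$ be an odd prime and for $k\ge1$ let $S_k=\sum_{a=1}^{(p-1)/2}a^k$. Then (i) $\displaystyle S_1+S_3+\dots+S_{p-2}=\sum_{\substack{j=1\\ j\text{ odd}}}^{p-2}\ \sum_{a=1}^{(p-1)/2}a^j\equiv-\frac12\pmod p$; (ii) $\displaystyle\sum_{\substack{j=1\\ j\text{ odd}}}^{p-2}\ \sum_{a=(p+1)/2}^{p-1}a^j\equiv\frac12\pmod p$.
   Context: Congruences are taken in $\mathbb{Z}_p$. *)

theory Defs
  imports Complex_Main "HOL-Number_Theory.Cong" "HOL-Computational_Algebra.Primes"
begin

definition half_power_sum :: "nat \<Rightarrow> nat \<Rightarrow> nat" where
  "half_power_sum p k = (\<Sum>a = 1..(p - 1) div 2. a ^ k)"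

text \<open>The rational numbers that lie in \<open>\<int>\<^sub>p\<close>: those whose reduced denominator is
  prime to \<open>p\<close>.\<close>

definition p_integral :: "nat \<Rightarrow> rat \<Rightarrow> bool" where
  "p_integral p x \<longleftrightarrow> \<not> int p dvd snd (quotient_of x)"

text \<open>The congruence \<open>x \<equiv> y (mod p)\<close> in \<open>\<int>\<^sub>p\<close> for rational \<open>x\<close>, \<open>y\<close>.  The library's \<^const>\<open>cong\<close>
  cannot be used on type \<^typ>\<open>rat\<close>: every nonzero modulus is a unit there, so the relation
  would be trivial.\<close>

definition zp_cong :: "nat \<Rightarrow> rat \<Rightarrow> rat \<Rightarrow> bool" where
  "zp_cong p x y \<longleftrightarrow>
     p_integral p x \<and> p_integral p y \<and> (\<exists>z. p_integral p z \<and> x - y = of_nat p * z)"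

lemma zp_cong_of_int_iff:
  assumes "prime p"
  shows "zp_cong p (of_int a) (of_int b) \<longleftrightarrow> [a = b] (mod int p)"
proof -
  have int: "p_integral p (of_int c)" for c
    using prime_gt_1_nat[OF assms] by (simp add: p_integral_def)
  show ?thesis
  proof
    assume "[a = b] (mod int p)"
    then obtain k where k: "a - b = int p * k"
      by (auto simp: cong_iff_dvd_diff)
    have "(of_int a :: rat) - of_int b = of_int (int p * k)"
      by (simp flip: k)
    then show "zp_cong p (of_int a) (of_int b)"
      using int by (auto simp: zp_cong_def)
  next
    assume "zp_cong p (of_int a) (of_int b)"
    then obtain z where z: "p_integral p z" "(of_int a :: rat) - of_int b = of_nat p * z"
      by (auto simp: zp_cong_def)
    obtain n d where nd: "quotient_of z = (n, d)" by fastforce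
    have d: "d > 0" "z = of_int n / of_int d"
      using quotient_of_denom_pos[OF nd] quotient_of_div[OF nd] by auto
    have "(of_int ((a - b) * d) :: rat) = of_int (int p * n)"
      using z(2) d by (simp add: field_simps)
    then have "(a - b) * d = int p * n" by (simp only: of_int_eq_iff)
    then have "int p dvd (a - b) * d" by simp
    moreover have "\<not> int p dvd d" using z(1) nd by (simp add: p_integral_def)
    moreover have "prime (int p)" using assms by simp
    ultimately have "int p dvd a - b" using prime_dvd_mult_iff by blast
    then show "[a = b] (mod int p)" by (simp add: cong_iff_dvd_diff)
  qed
qed

end

theory Submission
  imports Defs "HOL-Number_Theory.Residues"
begin

text \<open>Exchange the two sums. For a fixed base \<open>a\<close>, the sum of the odd powers \<open>a\<^sup>j\<close> with
  \<open>1 \<le> j \<le> p - 2\<close> is a geometric sum whose product with \<open>a\<^sup>2 - 1\<close> is \<open>a\<^sup>p - a\<close>, so it vanishes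
  modulo \<open>p\<close> unless \<open>a \<equiv> \<plusminus>1\<close>. In the lower half of the residues only \<open>a = 1\<close> survives, in the
  upper half only \<open>a = p - 1\<close>, with contributions \<open>(p - 1) / 2\<close> and \<open>- (p - 1) / 2\<close>.\<close>

text \<open>The reduced denominator divides every other denominator of the same fraction, so one
  denominator prime to \<open>p\<close> suffices.\<close>

lemma p_integral_divide:
  assumes "\<not> int p dvd b"
  shows "p_integral p (of_int a / of_int b)"
proof -
  obtain n d where nd: "quotient_of (of_int a / of_int b) = (n, d)" by fastforce
  have b: "b \<noteq> 0" using assms by auto
  have d: "d > 0" "(of_int a / of_int b :: rat) = of_int n / of_int d" "coprime n d"
    using quotient_of_denom_pos[OF nd] quotient_of_div[OF nd] quotient_of_coprime[OF nd] by auto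
  have "(of_int (a * d) :: rat) = of_int (n * b)"
    using d b by (simp add: field_simps)
  then have "a * d = n * b" by (simp only: of_int_eq_iff)
  then have "d dvd n * b" by (metis dvd_triv_right)
  then have "d dvd b"
    using d(3) by (simp add: coprime_dvd_mult_right_iff coprime_commute)
  then show ?thesis
    using assms nd dvd_trans by (auto simp: p_integral_def)
qed

text \<open>Clears denominators: \<open>c\<close> is a unit in the ring of p-adic integers, so the
  claims about halves reduce to integer congruences after doubling.\<close>

lemma zp_cong_divideI:
  assumes "prime p" "\<not> int p dvd c" "[a * c = b] (mod int p)"
  shows "zp_cong p (of_int a) (of_int b / of_int c)"
proof -
  have c: "c \<noteq> 0" using assms(2) by auto
  obtain k where k: "a * c - b = int p * k"
    using assms(3) by (auto simp: cong_iff_dvd_diff)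
  have "(of_int a - of_int b / of_int c :: rat) = of_int (a * c - b) / of_int c"
    using c by (simp add: field_simps)
  also have "\<dots> = of_nat p * (of_int k / of_int c)"
    by (simp add: k)
  finally have "(of_int a - of_int b / of_int c :: rat) = of_nat p * (of_int k / of_int c)" .
  moreover have "p_integral p (of_int a)"
    using p_integral_divide[of p 1 a] prime_gt_1_nat[OF assms(1)] by simp
  ultimately show ?thesis
    using p_integral_divide[OF assms(2)] unfolding zp_cong_def by blast
qed

text \<open>The bound keeps the shape that \<open>p - 2\<close> takes under
  \<open>p = 2 * m + 1\<close>. For \<open>m = 0\<close> truncated subtraction gives 0, and both
  sums are empty.\<close>

lemma sum_odd_reindex:
  fixes m :: nat
  shows "(\<Sum>j | j \<in> {1..2 * m + 1 - 2} \<and> odd j. f j) = (\<Sum>i<m. f (2 * i + 1))"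
proof -
  have "{j. j \<in> {1..2 * m + 1 - 2} \<and> odd j} = (\<lambda>i. 2 * i + 1) ` {..<m}"
    by (auto elim!: oddE)
  then show ?thesis
    by (simp add: sum.reindex inj_on_def)
qed

lemma geometric_sum_odd:
  fixes x :: "'a::comm_ring_1"
  shows "(x\<^sup>2 - 1) * (\<Sum>i<m. x ^ (2 * i + 1)) = x ^ (2 * m + 1) - x"
  by (induction m) (simp_all add: algebra_simps power2_eq_square)

lemma prime_dvd_odd_power_sum:
  assumes "prime (2 * m + 1)" "1 < a" "a < 2 * m"
  shows "int (2 * m + 1) dvd (\<Sum>i<m. int a ^ (2 * i + 1))"
proof -
  let ?p = "2 * m + 1"
  \<comment> \<open>Fermat applies because \<open>0 < a < ?p\<close>.\<close>
  have "[a ^ (?p - 1) = 1] (mod ?p)"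
    using assms by (intro fermat_theorem) (auto dest: dvd_imp_le)
  then have "[a ^ (2 * m) * a = 1 * a] (mod ?p)"
    by (intro cong_mult) simp_all
  then have "[int (a ^ ?p) = int a] (mod int ?p)"
    by (subst cong_int_iff) (simp add: mult.commute)
  then have "int ?p dvd int a ^ ?p - int a"
    by (simp add: cong_iff_dvd_diff)
  then have "int ?p dvd ((int a - 1) * (int a + 1)) * (\<Sum>i<m. int a ^ (2 * i + 1))"
    unfolding geometric_sum_odd[symmetric] by (simp add: algebra_simps power2_eq_square)
  \<comment> \<open>The bounds on \<open>a\<close> place both factors strictly between 0 and
    \<open>?p\<close>.\<close>
  moreover have "\<not> int ?p dvd int a - 1" "\<not> int ?p dvd int a + 1"
    using assms(2,3) by (auto dest!: zdvd_imp_le)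
  moreover have "prime (int ?p)"
    using assms(1) by (simp only: prime_nat_int_transfer)
  ultimately show ?thesis
    by (meson prime_dvd_mult_iff)
qed

lemma lower_half_cong:
  assumes "prime (2 * m + 1)"
  shows "[(\<Sum>i<m. \<Sum>a = 1..m. int a ^ (2 * i + 1)) = int m] (mod int (2 * m + 1))"
proof -
  have m: "m \<ge> 1" using assms by (cases m) auto
  have "(\<Sum>i<m. \<Sum>a = 1..m. int a ^ (2 * i + 1)) = (\<Sum>a = 1..m. \<Sum>i<m. int a ^ (2 * i + 1))"
    by (rule sum.swap)
  \<comment> \<open>The base \<open>a = 1\<close> is split off; it contributes 1 for each of the
    \<open>m\<close> exponents.\<close>
  also have "\<dots> = int m + (\<Sum>a = 2..m. \<Sum>i<m. int a ^ (2 * i + 1))"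
    using m by (subst sum.atLeast_Suc_atMost) (auto simp: numeral_2_eq_2)
  also have "[\<dots> = int m + 0] (mod int (2 * m + 1))"
  proof (intro cong_add cong_refl)
    show "[(\<Sum>a = 2..m. \<Sum>i<m. int a ^ (2 * i + 1)) = 0] (mod int (2 * m + 1))"
      unfolding cong_0_iff by (intro dvd_sum prime_dvd_odd_power_sum[OF assms]) auto
  qed
  finally show ?thesis by simp
qed

lemma upper_half_cong:
  assumes "prime (2 * m + 1)"
  shows "[(\<Sum>i<m. \<Sum>a = m + 1..2 * m. int a ^ (2 * i + 1)) = - int m] (mod int (2 * m + 1))"
proof -
  let ?p = "int (2 * m + 1)"
  have m: "m \<ge> 1" using assms by (cases m) auto
  \<comment> \<open>The base \<open>2 * m\<close> is -1 modulo \<open>?p\<close>, so its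
    \<open>m\<close> odd powers add up to \<open>- m\<close>. Every other base is at least 2, since
    \<open>m \<ge> 1\<close>.\<close>
  have "{m + 1..2 * m} = insert (2 * m) {m + 1..<2 * m}"
    using m by auto
  then have "(\<Sum>i<m. \<Sum>a = m + 1..2 * m. int a ^ (2 * i + 1)) =
      (\<Sum>i<m. int (2 * m) ^ (2 * i + 1)) + (\<Sum>a = m + 1..<2 * m. \<Sum>i<m. int a ^ (2 * i + 1))"
    by (subst sum.swap) simp
  also have "[\<dots> = (\<Sum>i<m. (- 1) ^ (2 * i + 1)) + 0] (mod ?p)"
  proof (intro cong_add cong_sum cong_pow)
    show "[int (2 * m) = - 1] (mod ?p)"
      by (simp add: cong_iff_dvd_diff add.commute)
    show "[(\<Sum>a = m + 1..<2 * m. \<Sum>i<m. int a ^ (2 * i + 1)) = 0] (mod ?p)"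
      unfolding cong_0_iff using m
      by (intro dvd_sum prime_dvd_odd_power_sum[OF assms]) auto
  qed
  finally show ?thesis by simp
qed

theorem theorem7:
  fixes p :: nat
  assumes "prime p" and "odd p"
  shows "(\<Sum>j | j \<in> {1..p - 2} \<and> odd j. half_power_sum p j) =
           (\<Sum>j | j \<in> {1..p - 2} \<and> odd j. \<Sum>a = 1..(p - 1) div 2. a ^ j) \<and>
         zp_cong p (of_nat (\<Sum>j | j \<in> {1..p - 2} \<and> odd j. \<Sum>a = 1..(p - 1) div 2. a ^ j)) (- 1 / 2) \<and>
         zp_cong p (of_nat (\<Sum>j | j \<in> {1..p - 2} \<and> odd j. \<Sum>a = (p + 1) div 2..p - 1. a ^ j)) (1 / 2)"
proof -
  obtain m where p: "p = 2 * m + 1"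
    using assms(2) by (auto elim: oddE)
  have prime: "prime (2 * m + 1)"
    using assms(1) p by simp
  have not_dvd: "\<not> int p dvd 2"
    using prime_gt_1_nat[OF assms(1)] p by (auto dest: zdvd_imp_le)
  define L where "L = (\<Sum>i<m. \<Sum>a = 1..m. a ^ (2 * i + 1))"
  define U where "U = (\<Sum>i<m. \<Sum>a = m + 1..2 * m. a ^ (2 * i + 1))"
  have L: "(\<Sum>j | j \<in> {1..p - 2} \<and> odd j. \<Sum>a = 1..(p - 1) div 2. a ^ j) = L"
    unfolding L_def p sum_odd_reindex by simp
  have U: "(\<Sum>j | j \<in> {1..p - 2} \<and> odd j. \<Sum>a = (p + 1) div 2..p - 1. a ^ j) = U"
    unfolding U_def p sum_odd_reindex by simp
  have "[int L = int m] (mod int p)"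
    using lower_half_cong[OF prime] by (simp add: L_def p)
  then have "[int L * 2 = int m * 2] (mod int p)"
    by (intro cong_mult cong_refl)
  \<comment> \<open>Here \<open>2 * m = p - 1\<close>.\<close>
  also have "[int m * 2 = - 1] (mod int p)"
    by (simp add: cong_iff_dvd_diff p algebra_simps)
  finally have L_cong: "zp_cong p (of_int (int L)) (of_int (- 1) / of_int 2)"
    by (rule zp_cong_divideI[OF assms(1) not_dvd])
  have "[int U = - int m] (mod int p)"
    using upper_half_cong[OF prime] by (simp add: U_def p)
  then have "[int U * 2 = - int m * 2] (mod int p)"
    by (intro cong_mult cong_refl)
  \<comment> \<open>The difference is \<open>- 2 * m - 1 = - p\<close>, hence the cofactor
    -1.\<close>
  also have "[- int m * 2 = 1] (mod int p)"
    unfolding cong_iff_dvd_diff p by (rule dvdI[of _ _ "- 1"]) simp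
  finally have U_cong: "zp_cong p (of_int (int U)) (of_int 1 / of_int 2)"
    by (rule zp_cong_divideI[OF assms(1) not_dvd])
  show ?thesis
    unfolding L U using L_cong U_cong L by (simp add: half_power_sum_def)
qed

end
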